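(* Let $f$ be a continuous probability density function on $(-\infty,\infty)$ all of whose absolute moments exist, let $h>0$, and for every nonnegative integer $n$ put $$a_n=\int_{-\infty}^{\infty}t^n f(t)\,dt,\qquad \tilde a_n=\frac1h\int_{-\infty}^{\infty}t^n\int_{-h/2}^{h/2}f(t+x)\,dx\,dt .$$ If the sequence $\{\tilde a_n\}$ is umbrally represented by the umbra $\tilde\alpha$ and the sequence $\{a_n\}$ is umbrally represented by the umbra $\alpha$, then $$\tilde\alpha\equiv \alpha+h\left(-1\boldsymbol{.}\iota-\tfrac12\right),$$ where $-1\boldsymbol{.}\iota$ is the inverse of the Bernoulli umbra $\iota$.
   Context: Classical umbral calculus: there is an alphabet $A$ of symbols called umbrae, the polynomial ring $\mathcal R=\mathbb R[x]$, and a linear functional $E:\mathcal R[A]\to\mathcal R$ (evaluation) with $E[1]=1$ and $E[x^n\alpha^i\beta^j\cdots\gamma^k]=x^nE[\alpha^i]E[\beta^j]\cdots E[\gamma^k]$ for any distinct umbrae $\alpha,\beta,\dots,\gamma\in A$ and nonnegative integers $n,i,j,\dots,k$ (distinct umbrae are uncorrelated). There is an umbra $\varepsilon\in A$ (augmentation) with $E[\varepsilon^n]=\delta_{0,n}$. The umbra $\alpha$ umbrally represents the sequence $a_0=1,a_1,a_2,\dots$ if $E[\alpha^n]=a_n$ for all $n\ge0$. For umbral polynomials $p,q\in\mathcal R[A]$, $p\simeq q$ means $E[p]=E[q]$, and $p\equiv q$ (similarity) means $p^n\simeq q^n$ for all integers $n\ge 0$. The inverse $-1\boldsymbol{.}\gamma$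 of an umbra $\gamma$ is an umbra uncorrelated with $\gamma$ such that $\gamma+(-1\boldsymbol{.}\gamma)\equiv\varepsilon$ (unique up to similarity). The Bernoulli umbra $\iota$ is the umbra (unique up to similarity) with $E[\iota^n]=B_n$ for all $n\ge0$, where $\{B_n\}$ are the Bernoulli numbers, $\sum_{n\ge0}B_nt^n/n!=t/(e^t-1)$ (so $B_1=-1/2$). The umbra $\alpha$ is distinct from (hence uncorrelated with) $\iota$ and $-1\boldsymbol{.}\iota$. *)

theory Defs
  imports
    "HOL-Analysis.Analysis"
    "HOL-Library.Poly_Mapping"
    "HOL-Computational_Algebra.Computational_Algebra"
begin

text \<open>
  The umbrae are the elements of the type \<open>'u\<close> (the alphabet). The ring of umbral
  polynomials is the polynomial ring over \<open>real poly\<close> in the indeterminates \<open>'u\<close>: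
  finitely supported maps from monomials to coefficients, with convolution as product.
\<close>

type_synonym 'u umbral_poly = "('u \<Rightarrow>\<^sub>0 nat) \<Rightarrow>\<^sub>0 real poly"

definition coef :: "real poly \<Rightarrow> 'u umbral_poly" where
  "coef p = Poly_Mapping.single 0 p"

definition real_const :: "real \<Rightarrow> 'u umbral_poly" where
  "real_const c = coef [:c:]"

definition umbra :: "'u \<Rightarrow> 'u umbral_poly" where
  "umbra u = Poly_Mapping.single (Poly_Mapping.single u 1) 1"

text \<open>
  \<open>monom 1 n\<close> is the power \<open>x\<^sup>n\<close> of the indeterminate of \<open>real poly\<close>. In \<open>E_uncorrelated\<close>
  the distinct umbrae and their exponents are given by a finite set \<open>S\<close> and a function \<open>k\<close>.
\<close>

locale umbral_calculus =
  fixes E :: "'u umbral_poly \<Rightarrow> real poly"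
    and eps :: 'u
  assumes E_add: "E (p + q) = E p + E q"
    and E_scale: "E (real_const c * p) = smult c (E p)"
    and E_one: "E 1 = 1"
    and E_uncorrelated: "finite S \<Longrightarrow>
          E (coef (monom 1 n) * (\<Prod>u\<in>S. umbra u ^ k u))
            = monom 1 n * (\<Prod>u\<in>S. E (umbra u ^ k u))"
    and E_augmentation: "E (umbra eps ^ n) = (if n = 0 then 1 else 0)"

definition represents :: "('u umbral_poly \<Rightarrow> real poly) \<Rightarrow> 'u \<Rightarrow> (nat \<Rightarrow> real poly) \<Rightarrow> bool" where
  "represents E u a \<longleftrightarrow> (\<forall>n. E (umbra u ^ n) = a n)"

definition umbrally_equiv ::
    "('u umbral_poly \<Rightarrow> real poly) \<Rightarrow> 'u umbral_poly \<Rightarrow> 'u umbral_poly \<Rightarrow> bool" where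
  "umbrally_equiv E p q \<longleftrightarrow> E p = E q"

definition similar ::
    "('u umbral_poly \<Rightarrow> real poly) \<Rightarrow> 'u umbral_poly \<Rightarrow> 'u umbral_poly \<Rightarrow> bool" where
  "similar E p q \<longleftrightarrow> (\<forall>n. umbrally_equiv E (p ^ n) (q ^ n))"

text \<open>
  An inverse is only unique up to similarity, hence a predicate: \<open>v\<close> is an inverse of \<open>u\<close>.
  Umbrae are uncorrelated exactly when they are distinct.
\<close>

definition is_inverse_umbra ::
    "('u umbral_poly \<Rightarrow> real poly) \<Rightarrow> 'u \<Rightarrow> 'u \<Rightarrow> 'u \<Rightarrow> bool" where
  "is_inverse_umbra E eps u v \<longleftrightarrow> u \<noteq> v \<and> similar E (umbra u + umbra v) (umbra eps)"

text \<open>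
  Division of power series cancels the common factor \<open>fps_X\<close>, so this is the
  series \<open>t / (e\<^sup>t - 1)\<close>, with \<open>B\<^sub>0 = 1\<close> and \<open>B\<^sub>1 = - 1 / 2\<close>.
\<close>

definition bernoulli :: "nat \<Rightarrow> real" where
  "bernoulli n = fact n * fps_nth (fps_X / (fps_exp 1 - 1)) n"

definition is_bernoulli_umbra :: "('u umbral_poly \<Rightarrow> real poly) \<Rightarrow> 'u \<Rightarrow> bool" where
  "is_bernoulli_umbra E u \<longleftrightarrow> represents E u (\<lambda>n. [:bernoulli n:])"

end

theory Submission
  imports Defs
begin

text \<open>
  The inverse of the Bernoulli umbra is a uniform random variable on \<open>[0, 1]\<close> in disguise: its
  exponential generating function is the reciprocal \<open>(e\<^sup>t - 1) / t\<close> of that of the Bernoulli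
  numbers, so its moments are \<open>1 / (n + 1)\<close> (\<open>E_inverse_bernoulli_power\<close>). Hence
  \<open>h (-1.\<iota> - 1/2)\<close> has the moments of the uniform distribution on \<open>[-h/2, h/2]\<close>.

  Averaging the density \<open>f\<close> over a window of length \<open>h\<close> gives the density of the sum of two
  independent random variables, one with density \<open>f\<close> and one uniform on \<open>[-h/2, h/2]\<close>. Moments of
  independent sums and evaluations of powers of sums of uncorrelated umbrae follow the same binomial
  rule, which is the assertion.

  Concretely, both sides are brought to the form
  \<open>\<Sum>j. (n choose j) a\<^sub>n\<^sub>-\<^sub>j h\<^sup>j m\<^sub>j\<close>, where \<open>m\<^sub>j\<close> is the \<open>j\<close>-th moment of the uniform
  distribution on \<open>[-1/2, 1/2]\<close>. On the umbral side (\<open>E_add_affine_power\<close>) \<open>m\<^sub>j\<close> appears as the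
  binomial expansion of the moment of a uniform variable on \<open>[0, 1]\<close> translated by \<open>-1/2\<close>, which
  \<open>sum_binomial_Suc_inverse\<close> evaluates. On the analytic side (\<open>moment_of_window_average\<close>) Fubini's
  theorem and a translation of the inner integral produce the powers \<open>(s - x)\<^sup>n\<close>, and their
  expansion produces the moments of \<open>f\<close> and the integrals of \<open>(-x)\<^sup>j\<close> over the window.
\<close>

section \<open>Evaluating polynomials in two uncorrelated umbrae\<close>

lemma sum_constant_polys: "(\<Sum>i\<in>A. [:g i:]) = [:\<Sum>i\<in>A. g i:]"
  for g :: "'a \<Rightarrow> real"
  by (induction A rule: infinite_finite_induct) simp_all

lemma real_const_mult: "real_const (c * d) = (real_const c * real_const d :: 'u umbral_poly)"
  by (simp add: real_const_def coef_def mult_single mult.commute)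

lemma real_const_add: "real_const (c + d) = (real_const c + real_const d :: 'u umbral_poly)"
  by (simp add: real_const_def coef_def flip: single_add)

lemma real_const_1: "real_const 1 = (1 :: 'u umbral_poly)"
  by (simp add: real_const_def coef_def one_pCons[symmetric])

lemma real_const_0: "real_const 0 = (0 :: 'u umbral_poly)"
  by (simp add: real_const_def coef_def)

lemma real_const_power: "real_const (c ^ n) = (real_const c ^ n :: 'u umbral_poly)"
  by (induction n) (simp_all add: real_const_1 real_const_mult)

lemma real_const_of_nat: "real_const (real n) = (of_nat n :: 'u umbral_poly)"
  by (induction n) (simp_all add: real_const_0 real_const_1 real_const_add)

lemma real_const_minus: "real_const (- c) = (- real_const c :: 'u umbral_poly)"
  by (simp add: real_const_def coef_def flip: single_uminus)

context umbral_calculus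
begin

lemma E_sum: "E (\<Sum>i\<in>A. p i) = (\<Sum>i\<in>A. E (p i))"
proof -
  have z: "E 0 = 0"
    using E_add[of 0 0] by simp
  show ?thesis by (induction A rule: infinite_finite_induct) (simp_all add: z E_add)
qed

lemma E_mult_powers:
  assumes "u \<noteq> v"
  shows "E (umbra u ^ i * umbra v ^ j) = E (umbra u ^ i) * E (umbra v ^ j)"
proof -
  have "coef (monom 1 0) = (1 :: 'u umbral_poly)"
    by (simp add: coef_def)
  then show ?thesis
    using E_uncorrelated[of "{u, v}" 0 "\<lambda>w. if w = u then i else j"] assms by simp
qed

lemma E_add_power:
  assumes "u \<noteq> v"
  shows "E ((umbra u + umbra v) ^ n)
    = (\<Sum>k\<le>n. smult (n choose k) (E (umbra u ^ k) * E (umbra v ^ (n - k))))"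
  by (simp add: binomial_ring E_sum mult.assoc E_scale E_mult_powers assms flip: real_const_of_nat)

text \<open>
  The inner sum is the \<open>j\<close>-th moment of \<open>v + c\<close>, and the outer one the moment of a sum of the
  uncorrelated quantities \<open>u\<close> and \<open>h (v + c)\<close>. The expansion is done in the polynomial ring first,
  because the axioms of evaluation give multiplicativity for products of powers of umbrae only.
\<close>

lemma E_add_affine_power:
  fixes p q :: "nat \<Rightarrow> real" and h c :: real
  assumes "u \<noteq> v"
    and "\<And>n. E (umbra u ^ n) = [:p n:]" and "\<And>n. E (umbra v ^ n) = [:q n:]"
  shows "E ((umbra u + real_const h * (umbra v + real_const c)) ^ n)
    = [:\<Sum>j\<le>n. (n choose j) * p (n - j) * h ^ j *
          (\<Sum>i\<le>j. (j choose i) * c ^ (j - i) * q i):]"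
proof -
  let ?U = "umbra u" and ?V = "umbra v"
  have inner: "(?V + real_const c) ^ j
      = (\<Sum>i\<le>j. real_const ((j choose i) * c ^ (j - i)) * ?V ^ i)" for j
    by (simp add: binomial_ring real_const_mult real_const_power real_const_of_nat mult.assoc
        mult.commute[of "?V ^ _"])
  have "(?U + real_const h * (?V + real_const c)) ^ n
     = (real_const h * (?V + real_const c) + ?U) ^ n"
    by (simp only: add.commute)
  also have "\<dots> = (\<Sum>j\<le>n. real_const ((n choose j) * h ^ j) * (?V + real_const c) ^ j
      * ?U ^ (n - j))"
    by (simp add: binomial_ring[of _ ?U] power_mult_distrib real_const_mult real_const_power
        real_const_of_nat mult.assoc)
  also have "\<dots> = (\<Sum>j\<le>n. \<Sum>i\<le>j. real_const ((n choose j) * h ^ j * ((j choose i) * c ^ (j - i)))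
          * (?U ^ (n - j) * ?V ^ i))"
    unfolding inner sum_distrib_left sum_distrib_right
    by (intro sum.cong refl) (simp only: real_const_mult mult_ac)
  finally have "(?U + real_const h * (?V + real_const c)) ^ n
     = (\<Sum>j\<le>n. \<Sum>i\<le>j. real_const ((n choose j) * h ^ j * ((j choose i) * c ^ (j - i)))
          * (?U ^ (n - j) * ?V ^ i))" .
  then have "E ((?U + real_const h * (?V + real_const c)) ^ n)
     = (\<Sum>j\<le>n. \<Sum>i\<le>j. [:(n choose j) * h ^ j * ((j choose i) * c ^ (j - i)) * (q i * p (n - j)):])"
    by (simp only: E_sum E_scale E_mult_powers[OF assms(1)] assms(2,3)) simp
  also have "\<dots> = (\<Sum>j\<le>n. \<Sum>i\<le>j. [:(n choose j) * p (n - j) * h ^ j * ((j choose i) * c ^ (j - i) * q i):])"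
    by (simp only: mult_ac)
  finally show ?thesis
    by (simp only: sum_constant_polys sum_distrib_left)
qed

end

section \<open>The inverse of the Bernoulli umbra\<close>

text \<open>
  Both sides are the integral of \<open>(y + c)\<^sup>n\<close> over \<open>0 \<le> y \<le> 1\<close>. The proof avoids the integral: absorbing
  \<open>1 / (i + 1)\<close> into the binomial coefficient turns the left side into the expansion of
  \<open>(1 + c)\<^sup>n\<^sup>+\<^sup>1\<close> without its first term.
\<close>

lemma sum_binomial_Suc_inverse:
  fixes c :: real
  shows "(\<Sum>i\<le>n. (n choose i) * c ^ (n - i) * (1 / Suc i)) = ((1 + c) ^ Suc n - c ^ Suc n) / Suc n"
proof -
  have "(n choose i) * c ^ (n - i) * (1 / Suc i) = (Suc n choose Suc i) * c ^ (n - i) / Suc n" for i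
  proof -
    have "Suc i * (Suc n choose Suc i) = Suc n * (n choose i)"
      by (rule Suc_times_binomial)
    then have "real (Suc i) * (Suc n choose Suc i) = real (Suc n) * (n choose i)"
      by (metis of_nat_mult)
    then show ?thesis by (simp add: field_simps del: binomial_Suc_Suc of_nat_Suc)
  qed
  then have "(\<Sum>i\<le>n. (n choose i) * c ^ (n - i) * (1 / Suc i))
     = (\<Sum>i\<le>n. (Suc n choose Suc i) * c ^ (n - i)) / Suc n"
    by (simp only: sum_divide_distrib)
  moreover have "(1 + c) ^ Suc n = c ^ Suc n + (\<Sum>i\<le>n. (Suc n choose Suc i) * c ^ (n - i))"
    unfolding binomial_ring by (subst sum.atMost_Suc_shift) simp
  ultimately show ?thesis by simp
qed

text \<open>
  This compares the coefficients of \<open>t\<^sup>n / n!\<close> in \<open>(t / (e\<^sup>t - 1)) * ((e\<^sup>t - 1) / t) = 1\<close>.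
\<close>

lemma bernoulli_convolution:
  "(\<Sum>k\<le>n. (n choose k) * bernoulli k * (1 / Suc (n - k))) = (if n = 0 then 1 else 0)"
proof -
  define B G :: "real fps" where "B = fps_X / (fps_exp 1 - 1)"
    and "G = fps_shift 1 (fps_exp 1 - 1)"
  have XG: "fps_X * G = fps_exp 1 - 1"
    by (rule fps_ext) (auto simp: G_def)
  have "fps_nth G 0 = 1" by (simp add: G_def)
  then have "is_unit G" by simp
  \<comment> \<open>Division of power series inverts multiplication only where it is exact.\<close>
  then have "(fps_exp 1 - 1 :: real fps) dvd fps_X"
    unfolding XG[symmetric] by (simp add: mult_unit_dvd_iff)
  then have "fps_X * (G * B) = fps_X"
    unfolding mult.assoc[symmetric] XG B_def by (rule dvd_mult_div_cancel)
  then have BG: "B * G = 1" by (simp add: mult.commute)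
  have "(n choose k) * bernoulli k * (1 / Suc (n - k))
      = fact n * (fps_nth B k * fps_nth G (n - k))" if "k \<le> n" for k
    using that by (simp add: bernoulli_def binomial_fact B_def G_def field_simps)
  then have "(\<Sum>k\<le>n. (n choose k) * bernoulli k * (1 / Suc (n - k))) = fact n * fps_nth (B * G) n"
    by (simp add: fps_mult_nth sum_distrib_left atMost_atLeast0)
  then show ?thesis by (simp add: BG)
qed

lemma bernoulli_0: "bernoulli 0 = 1"
  using bernoulli_convolution[of 0] by simp

context umbral_calculus
begin

text \<open>
  Evaluating \<open>(\<iota> + -1.\<iota>)\<^sup>n\<close> gives a triangular linear system for the moments of the inverse, with
  diagonal entries \<open>B\<^sub>0 = 1\<close>. It therefore has only one solution, and by
  \<open>bernoulli_convolution\<close> the numbers \<open>1 / (n + 1)\<close> are one.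
\<close>

lemma E_inverse_bernoulli_power:
  assumes "is_bernoulli_umbra E u" and "is_inverse_umbra E eps u v"
  shows "E (umbra v ^ n) = [:1 / Suc n:]"
proof (induction n rule: less_induct)
  case (less n)
  have neq: "u \<noteq> v" and sim: "E ((umbra u + umbra v) ^ n) = E (umbra eps ^ n)"
    using assms(2) by (auto simp: is_inverse_umbra_def similar_def umbrally_equiv_def)
  have B: "E (umbra u ^ k) = [:bernoulli k:]" for k
    using assms(1) by (auto simp: is_bernoulli_umbra_def represents_def)
  have split_first: "(\<Sum>k\<le>n. F k) = F 0 + (\<Sum>k\<in>{1..n}. F k)"
    for F :: "nat \<Rightarrow> 'z::comm_monoid_add"
    by (simp add: sum.atMost_shift sum.atLeast1_atMost_eq)
  have IH: "(\<Sum>k\<in>{1..n}. smult (n choose k) (E (umbra u ^ k) * E (umbra v ^ (n - k))))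
      = [:\<Sum>k\<in>{1..n}. (n choose k) * bernoulli k * (1 / Suc (n - k)):]"
    unfolding sum_constant_polys[symmetric]
    by (rule sum.cong) (simp_all add: B less.IH)
  have "[:if n = 0 then 1 else 0:] = E ((umbra u + umbra v) ^ n)"
    unfolding sim by (simp add: E_augmentation one_pCons)
  also have "\<dots> = E (umbra v ^ n)
      + [:\<Sum>k\<in>{1..n}. (n choose k) * bernoulli k * (1 / Suc (n - k)):]"
    unfolding E_add_power[OF neq] split_first IH by (simp add: E_one)
  finally have "[:if n = 0 then 1 else 0:] = E (umbra v ^ n)
      + [:\<Sum>k\<in>{1..n}. (n choose k) * bernoulli k * (1 / Suc (n - k)):]" .
  moreover have "(if n = 0 then 1 else 0) = 1 / Suc n
      + (\<Sum>k\<in>{1..n}. (n choose k) * bernoulli k * (1 / Suc (n - k)))"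
    using bernoulli_convolution[of n] by (simp add: split_first bernoulli_0)
  ultimately have "E (umbra v ^ n)
      + [:\<Sum>k\<in>{1..n}. (n choose k) * bernoulli k * (1 / Suc (n - k)):]
      = [:1 / Suc n:] + [:\<Sum>k\<in>{1..n}. (n choose k) * bernoulli k * (1 / Suc (n - k)):]"
    by (simp only: add_pCons add.right_neutral)
  then show ?case
    by (rule add_right_imp_eq)
qed

end

section \<open>Moments of a density averaged over a window\<close>

lemma integrable_abs_plus_power_times:
  fixes f :: "real \<Rightarrow> real" and c :: real
  assumes m: "\<And>n::nat. integrable lborel (\<lambda>t. \<bar>t\<bar> ^ n * f t)"
  shows "integrable lborel (\<lambda>t. (\<bar>t\<bar> + c) ^ n * f t)"
proof -
  have "(\<lambda>t. (\<bar>t\<bar> + c) ^ n * f t) = (\<lambda>t. \<Sum>k\<le>n. (n choose k) * c ^ (n - k) * (\<bar>t\<bar> ^ k * f t))"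
    by (simp add: binomial_ring sum_distrib_right) (simp only: mult_ac)
  then show ?thesis by (simp add: m)
qed

lemma lborel_integral_shift: "(LBINT t. g (t + x)) = (LBINT t. g t)"
  for g :: "real \<Rightarrow> real"
  using lborel_integral_real_affine[of 1 g x] by (simp add: add.commute)

lemma lborel_integrable_shift_iff: "integrable lborel (\<lambda>t. g (t + x)) \<longleftrightarrow> integrable lborel g"
  for g :: "real \<Rightarrow> real"
  using lborel_integrable_real_affine_iff[of 1 g x] by (simp add: add.commute)

text \<open>
  After exchanging the integrals, the substitution \<open>s = t + x\<close> moves the translation from \<open>f\<close>
  to the power, where the binomial theorem separates \<open>s\<close> from \<open>x\<close>. The factor
  \<open>((1 / 2)\<^sup>j\<^sup>+\<^sup>1 - (-1 / 2)\<^sup>j\<^sup>+\<^sup>1) / (j + 1)\<close> is the integral of \<open>y\<^sup>j\<close> over \<open>[-1/2, 1/2]\<close>.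
\<close>

lemma moment_of_window_average:
  fixes f :: "real \<Rightarrow> real"
  assumes f_meas: "f \<in> borel_measurable borel" and f_nonneg: "\<And>t. 0 \<le> f t"
    and m: "\<And>n::nat. integrable lborel (\<lambda>t. \<bar>t\<bar> ^ n * f t)"
    and "h > 0"
  shows "1 / h * (LBINT t. t ^ n * (LBINT x:{-h/2..h/2}. f (t + x)))
    = (\<Sum>j\<le>n. (n choose j) * (LBINT t. t ^ (n - j) * f t) * h ^ j
         * (((1 / 2) ^ Suc j - (- 1 / 2) ^ Suc j) / Suc j))"
proof -
  let ?I = "{-h/2..h/2}"
  let ?F = "\<lambda>x t. indicator ?I x * (t ^ n * f (t + x))"
  note f_meas[measurable]
  have int_shift: "integrable lborel (\<lambda>s. (s - x) ^ n * f s)" for x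
  proof (rule Bochner_Integration.integrable_bound)
    show "integrable lborel (\<lambda>s. (\<bar>s\<bar> + \<bar>x\<bar>) ^ n * f s)"
      by (rule integrable_abs_plus_power_times) (rule m)
    show "AE s in lborel. norm ((s - x) ^ n * f s) \<le> norm ((\<bar>s\<bar> + \<bar>x\<bar>) ^ n * f s)"
      by (auto simp: abs_mult power_abs f_nonneg intro!: mult_right_mono power_mono)
  qed measurable
  have inner: "integrable lborel (?F x)" for x
    using lborel_integrable_shift_iff[of "\<lambda>s. (s - x) ^ n * f s" x] int_shift by simp
  have int_norm: "integrable lborel (\<lambda>x. LBINT t. norm (?F x t))"
  proof (rule Bochner_Integration.integrable_bound)
    \<comment> \<open>A bound on the inner integrals that is uniform in the window: there \<open>\<bar>s - x\<bar> \<le> \<bar>s\<bar> + h\<close>.\<close>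
    let ?C = "LBINT s. (\<bar>s\<bar> + h) ^ n * f s"
    show "integrable lborel (\<lambda>x. indicator ?I x * ?C)"
      by (rule integrable_mult_left) (simp add: integrable_indicator_iff emeasure_lborel_Icc_eq)
    have "(LBINT t. norm (?F x t)) \<le> indicator ?I x * ?C" for x
    proof (cases "x \<in> ?I")
      case True
      have "(LBINT t. norm (?F x t)) = (LBINT t. \<bar>t + x - x\<bar> ^ n * f (t + x))"
        using True by (simp add: abs_mult power_abs f_nonneg)
      also have "\<dots> = (LBINT s. \<bar>s - x\<bar> ^ n * f s)"
        by (rule lborel_integral_shift)
      also have "\<dots> \<le> ?C"
      proof (rule integral_mono)
        show "integrable lborel (\<lambda>s. \<bar>s - x\<bar> ^ n * f s)"
          using integrable_norm[OF int_shift[of x]] by (simp add: abs_mult power_abs f_nonneg)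
        show "integrable lborel (\<lambda>s. (\<bar>s\<bar> + h) ^ n * f s)"
          by (rule integrable_abs_plus_power_times) (rule m)
        show "\<bar>s - x\<bar> ^ n * f s \<le> (\<bar>s\<bar> + h) ^ n * f s" for s
          using True \<open>h > 0\<close> by (auto simp: f_nonneg intro!: mult_right_mono power_mono)
      qed
      finally show ?thesis using True by simp
    qed simp
    moreover have "norm (LBINT t. norm (?F x t)) = (LBINT t. norm (?F x t))" for x
      unfolding real_norm_def by (rule abs_of_nonneg, rule integral_nonneg_AE) simp
    ultimately have "norm (LBINT t. norm (?F x t)) \<le> norm (indicator ?I x * ?C)" for x
      using abs_ge_self[of "indicator ?I x * ?C"] unfolding real_norm_def[of "_ * ?C"]
      by (simp only:) (rule order_trans)
    then show "AE x in lborel. norm (LBINT t. norm (?F x t)) \<le> norm (indicator ?I x * ?C)"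
      by (rule AE_I2)
  qed measurable
  have prod_int: "integrable (lborel \<Otimes>\<^sub>M lborel) (case_prod ?F)"
  proof (rule lborel_pair.Fubini_integrable)
    show "integrable lborel (\<lambda>x. LBINT t. norm (case_prod ?F (x, t)))"
      using int_norm by (simp only: case_prod_conv)
    show "AE x in lborel. integrable lborel (\<lambda>t. case_prod ?F (x, t))"
      using inner by (simp only: case_prod_conv) simp
  qed measurable
  have "t ^ n * (LBINT x:?I. f (t + x)) = (LBINT x. ?F x t)" for t
    by (simp add: set_lebesgue_integral_def mult.left_commute[of "indicator _ _"])
  then have "(LBINT t. t ^ n * (LBINT x:?I. f (t + x))) = (LBINT t. LBINT x. ?F x t)"
    by (simp only:)
  also have "\<dots> = (LBINT x. LBINT t. ?F x t)"
    by (rule lborel_pair.Fubini_integral[OF prod_int])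
  also have "\<dots> = (LBINT x. indicator ?I x * (LBINT s. (s - x) ^ n * f s))"
    using lborel_integral_shift[of "\<lambda>s. (s - x) ^ n * f s" x for x] by simp
  also have "\<dots> = (LBINT x. \<Sum>j\<le>n. (n choose j) * (LBINT s. s ^ (n - j) * f s) * (- 1) ^ j
                     * (x ^ j * indicator ?I x))"
  proof -
    have mom: "integrable lborel (\<lambda>s. s ^ k * f s)" for k
      by (rule Bochner_Integration.integrable_bound[OF m[of k]]) (auto simp: abs_mult power_abs)
    have "(\<lambda>s. (s - x) ^ n * f s)
       = (\<lambda>s. \<Sum>j\<le>n. (n choose j) * (- 1) ^ j * x ^ j * (s ^ (n - j) * f s))" for x :: real
    proof
      fix s :: real
      have "(s - x) ^ n = (- x + s) ^ n" by simp
      also have "\<dots> = (\<Sum>j\<le>n. (n choose j) * (- 1) ^ j * x ^ j * s ^ (n - j))"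
        unfolding binomial_ring by (simp add: power_minus[of x] mult_ac)
      finally show "(s - x) ^ n * f s = (\<Sum>j\<le>n. (n choose j) * (- 1) ^ j * x ^ j * (s ^ (n - j) * f s))"
        by (simp add: sum_distrib_right mult.assoc)
    qed
    then have "(LBINT s. (s - x) ^ n * f s)
        = (\<Sum>j\<le>n. real (n choose j) * (- 1) ^ j * x ^ j * (LBINT s. s ^ (n - j) * f s))" for x :: real
      by (simp add: mom)
    then show ?thesis
      by (simp only: sum_distrib_left mult_ac)
  qed
  also have "\<dots> = (\<Sum>j\<le>n. (n choose j) * (LBINT s. s ^ (n - j) * f s) * (- 1) ^ j
                     * (((h / 2) ^ Suc j - (- h / 2) ^ Suc j) / Suc j))"
  proof -
    have "integrable lborel (\<lambda>x. x ^ j * indicator ?I x :: real)" for j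
      using borel_integrable_compact[of ?I "\<lambda>x. x ^ j"]
      by (simp add: continuous_intros mult.commute indicator_def if_distrib cong: if_cong)
    then show ?thesis using \<open>h > 0\<close> by (simp add: integral_power)
  qed
  finally have eq: "(LBINT t. t ^ n * (LBINT x:?I. f (t + x))) = \<dots>" .
  \<comment> \<open>The sign \<open>(-1)\<^sup>j\<close> is absorbed because the odd moments of the symmetric window vanish.\<close>
  have scale: "1 / h * ((- 1) ^ j * (((h / 2) ^ Suc j - (- h / 2) ^ Suc j) / Suc j))
     = h ^ j * (((1 / 2) ^ Suc j - (- 1 / 2) ^ Suc j) / Suc j)" for j
    using \<open>h > 0\<close> by (cases "even j")
      (simp_all add: power_divide power_minus_odd power_minus_even field_simps)
  have "1 / h * (A * (- 1) ^ j * (((h / 2) ^ Suc j - (- h / 2) ^ Suc j) / Suc j))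
     = A * h ^ j * (((1 / 2) ^ Suc j - (- 1 / 2) ^ Suc j) / Suc j)" for A :: real and j
    using arg_cong[OF scale[of j], of "\<lambda>z. A * z"] by (simp only: mult_ac)
  then show ?thesis
    unfolding eq sum_distrib_left by (intro sum.cong refl)
qed

theorem theorem3p1:
  fixes f :: "real \<Rightarrow> real" and h :: real
    and a a' :: "nat \<Rightarrow> real"
    and E :: "'u umbral_poly \<Rightarrow> real poly"
    and eps \<alpha> \<alpha>' \<iota> \<iota>_inv :: 'u
  assumes "umbral_calculus E eps"
    and "continuous_on UNIV f"
    and "\<forall>t. 0 \<le> f t"
    and "integrable lborel f" and "(LBINT t. f t) = 1"
    and "\<forall>n::nat. integrable lborel (\<lambda>t. \<bar>t\<bar> ^ n * f t)"
    and "h > 0"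
    and "\<forall>n. a n = (LBINT t. t ^ n * f t)"
    and "\<forall>n. a' n = 1 / h * (LBINT t. t ^ n * (LBINT x:{-h/2..h/2}. f (t + x)))"
    and "represents E \<alpha>' (\<lambda>n. [:a' n:])"
    and "represents E \<alpha> (\<lambda>n. [:a n:])"
    and "is_bernoulli_umbra E \<iota>"
    and "is_inverse_umbra E eps \<iota> \<iota>_inv"
    and "\<alpha> \<noteq> \<iota>" and "\<alpha> \<noteq> \<iota>_inv"
  shows "similar E (umbra \<alpha>')
           (umbra \<alpha> + real_const h * (umbra \<iota>_inv - real_const (1 / 2)))"
proof -
  interpret umbral_calculus E eps
    by (rule assms(1))
  have minus_half: "umbra \<iota>_inv - real_const (1 / 2) = umbra \<iota>_inv + real_const (- 1 / 2)"
    by (simp add: real_const_minus)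
  have E_\<alpha>: "E (umbra \<alpha> ^ n) = [:a n:]" and E_\<alpha>': "E (umbra \<alpha>' ^ n) = [:a' n:]" for n
    using assms(10,11) by (simp_all add: represents_def)
  have E_inv: "E (umbra \<iota>_inv ^ n) = [:1 / Suc n:]" for n
    using assms(12,13) by (rule E_inverse_bernoulli_power)
  have "E (umbra \<alpha>' ^ n)
      = E ((umbra \<alpha> + real_const h * (umbra \<iota>_inv + real_const (- 1 / 2))) ^ n)" for n
  proof -
    have "E ((umbra \<alpha> + real_const h * (umbra \<iota>_inv + real_const (- 1 / 2))) ^ n)
        = [:\<Sum>j\<le>n. (n choose j) * a (n - j) * h ^ j
            * (\<Sum>i\<le>j. (j choose i) * (- 1 / 2) ^ (j - i) * (1 / Suc i)):]"
      by (rule E_add_affine_power[OF assms(15) E_\<alpha> E_inv])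
    also have "\<dots> = [:\<Sum>j\<le>n. (n choose j) * a (n - j) * h ^ j
            * (((1 / 2) ^ Suc j - (- 1 / 2) ^ Suc j) / Suc j):]"
      unfolding sum_binomial_Suc_inverse by simp
    also have "\<dots> = [:a' n:]"
    proof -
      have "f \<in> borel_measurable borel"
        using assms(2) by (rule borel_measurable_continuous_onI)
      from moment_of_window_average[OF this, of h n] assms(3,6,7) show ?thesis
        by (simp only: assms(8)[rule_format] assms(9)[rule_format])
    qed
    finally show ?thesis
      by (simp only: E_\<alpha>')
  qed
  then show ?thesis
    by (simp only: similar_def umbrally_equiv_def minus_half) simp
qed

end
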